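(* Let $\mathfrak S=(V_\circ\cup V_\times,E)$ be a pre-Speiser graph embedded in the plane, with $V_\circ$ and $V_\times$ of the same (possibly infinite) cardinality, and for a vertex $v$ let $\rho_v$ denote its valence. Let $2\le{\tt q}<\infty$ be an integer with $2\le\rho_v\le{\tt q}$ for all vertices $v$ and with ${\tt q}\le\#\{\text{faces of }\mathfrak S\text{ that are not digons}\}$. Then $\mathfrak S$ extends to a Speiser graph $\mathfrak S_{\tt q}$ of index ${\tt q}$ if and only if $\mathfrak S$ satisfies the following conditions: 1) (Global balance) $\displaystyle\sum_{v\in V_\circ}({\tt q}-\rho_v)=\sum_{w\in V_\times}({\tt q}-\rho_w)$. 2) (Local balance / Hall neighborhood inequalities) for every finite sets $S\subset V_\circ$ and $T\subset V_\times$, $$\sum_{v\in S}({\tt q}-\rho_v)\le\sum_{w\in N(S)}({\tt q}-\rho_w),\qquad \sum_{w\in T}({\tt q}-\rho_w)\le\sum_{v\in N(T)}({\tt q}-\rho_v).$$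
   Context: A pre-Speiser graph $\mathfrak S$ is a connected, locally finite (every vertex has finite valence and compact sets meet finitely many edges), bipartite multigraph with finite or countable vertex set partitioned in $\circ$-vertices $V_\circ$ and $\times$-vertices $V_\times$, properly embedded in $\mathbb S^2$ when it is finite or in the open unit disk $B(0,1)$ when it is infinite, in which each vertex has valence $\rho$ with $2\le\rho\le{\tt q}$ (the valence may vary with the vertex). A Speiser graph of index ${\tt q}$ is the same with every vertex of valence exactly ${\tt q}$. The faces of $\mathfrak S$ are the connected components of the complement of $\mathfrak S$ in $\mathbb S^2$ (resp. $B(0,1)$); a digon is a face bounded by two edges. $\mathfrak S$ extends to a Speiser graph $\mathfrak S_{\tt q}$ of index ${\tt q}$ means that by adding only parallel copies of edges of $E$ one obtains a planar ${\tt q}$-regular bipartite multigraph $(V_\circ\cup V_\times,E\cup E_{new})$; i.e. there are non-negative integers $x(e)$, $e\in E$, such that replacing each $e$ by a bundle of $1+x(e)$ parallel edges makes every vertex have valence ${\tt q}$. For a vertex $v$, $N(v)$ is the set of vertices adjacent to $v$; for a set $S$ of vertices $N(S)=\big(\bigcup_{v\in S}N(v)\big)\setminus S$. *)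

theory Defs
  imports "HOL-Analysis.Analysis" "HOL-Library.Equipollence" "HOL-Library.Extended_Nat"
begin

(* Parallel edges are distinct elements of edges having the same two ends. *)
record ('v, 'e) bip_multigraph =
  circ_verts :: "'v set"
  cross_verts :: "'v set"
  edges :: "'e set"
  circ_end :: "'e \<Rightarrow> 'v"
  cross_end :: "'e \<Rightarrow> 'v"

definition verts :: "('v, 'e, 'm) bip_multigraph_scheme \<Rightarrow> 'v set" where
  "verts G = circ_verts G \<union> cross_verts G"

definition bipartite_multigraph :: "('v, 'e, 'm) bip_multigraph_scheme \<Rightarrow> bool" where
  "bipartite_multigraph G \<longleftrightarrow>
     circ_verts G \<inter> cross_verts G = {} \<and>
     (\<forall>e \<in> edges G. circ_end G e \<in> circ_verts G \<and> cross_end G e \<in> cross_verts G)"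

definition incident_edges :: "('v, 'e, 'm) bip_multigraph_scheme \<Rightarrow> 'v \<Rightarrow> 'e set" where
  "incident_edges G v = {e \<in> edges G. circ_end G e = v \<or> cross_end G e = v}"

definition valence :: "('v, 'e, 'm) bip_multigraph_scheme \<Rightarrow> 'v \<Rightarrow> nat" where
  "valence G v = card (incident_edges G v)"

definition adjacent :: "('v, 'e, 'm) bip_multigraph_scheme \<Rightarrow> 'v \<Rightarrow> 'v \<Rightarrow> bool" where
  "adjacent G v w \<longleftrightarrow> (\<exists>e \<in> edges G. {circ_end G e, cross_end G e} = {v, w})"

definition neighbourhood :: "('v, 'e, 'm) bip_multigraph_scheme \<Rightarrow> 'v set \<Rightarrow> 'v set" where
  "neighbourhood G S = (\<Union>v \<in> S. {w. adjacent G v w}) - S"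

definition connected_graph :: "('v, 'e, 'm) bip_multigraph_scheme \<Rightarrow> bool" where
  "connected_graph G \<longleftrightarrow> (\<forall>v \<in> verts G. \<forall>w \<in> verts G. (adjacent G)\<^sup>*\<^sup>* v w)"

(* The sphere S^2 and the open unit disk are both realised inside the 3-dimensional
   Euclidean space complex * real, the disk lying in the plane complex * {0}. *)
type_synonym point = "complex \<times> real"

definition two_sphere :: "point set" where
  "two_sphere = sphere 0 1"

definition unit_disk :: "point set" where
  "unit_disk = ball 0 1 \<times> {0}"

record ('v, 'e) drawn_graph = "('v, 'e) bip_multigraph" +
  pos :: "'v \<Rightarrow> point"
  curve :: "'e \<Rightarrow> real \<Rightarrow> point"

definition surface :: "('v, 'e) drawn_graph \<Rightarrow> point set" where
  "surface G = (if finite (verts G) then two_sphere else unit_disk)"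

(* The last clause is properness of the embedding, i.e. compact subsets of the surface
   meet only finitely many edges. *)
definition properly_embedded :: "('v, 'e) drawn_graph \<Rightarrow> bool" where
  "properly_embedded G \<longleftrightarrow>
     inj_on (pos G) (verts G) \<and> pos G ` verts G \<subseteq> surface G \<and>
     (\<forall>e \<in> edges G. arc (curve G e) \<and> path_image (curve G e) \<subseteq> surface G \<and>
        pathstart (curve G e) = pos G (circ_end G e) \<and>
        pathfinish (curve G e) = pos G (cross_end G e) \<and>
        path_image (curve G e) \<inter> pos G ` verts G =
          {pos G (circ_end G e), pos G (cross_end G e)}) \<and>
     (\<forall>e \<in> edges G. \<forall>e' \<in> edges G. e \<noteq> e' \<longrightarrow>
        path_image (curve G e) \<inter> path_image (curve G e') \<subseteq> pos G ` verts G) \<and>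
     (\<forall>K. compact K \<and> K \<subseteq> surface G \<longrightarrow>
        finite {e \<in> edges G. path_image (curve G e) \<inter> K \<noteq> {}})"

definition pre_speiser_graph :: "nat \<Rightarrow> ('v, 'e) drawn_graph \<Rightarrow> bool" where
  "pre_speiser_graph q G \<longleftrightarrow>
     bipartite_multigraph G \<and> countable (verts G) \<and> connected_graph G \<and>
     properly_embedded G \<and>
     (\<forall>v \<in> verts G. finite (incident_edges G v) \<and> 2 \<le> valence G v \<and> valence G v \<le> q)"

definition faces :: "('v, 'e) drawn_graph \<Rightarrow> point set set" where
  "faces G = components
     (surface G - (pos G ` verts G \<union> (\<Union>e \<in> edges G. path_image (curve G e))))"

(* The boundary is taken relative to the surface: the sphere and the disk have empty
   interior in the ambient space. *)
definition digon :: "('v, 'e) drawn_graph \<Rightarrow> point set \<Rightarrow> bool" where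
  "digon G F \<longleftrightarrow> F \<in> faces G \<and>
     (\<exists>e \<in> edges G. \<exists>e' \<in> edges G. e \<noteq> e' \<and>
        (top_of_set (surface G)) frontier_of F =
          path_image (curve G e) \<union> path_image (curve G e'))"

(* Each edge e becomes a bundle of 1 + x e parallel edges (e, 0), ..., (e, x e);
   (e, 0) is the original edge. *)
definition bundle_graph ::
  "('v, 'e, 'm) bip_multigraph_scheme \<Rightarrow> ('e \<Rightarrow> nat) \<Rightarrow> ('v, 'e \<times> nat) bip_multigraph" where
  "bundle_graph G x =
     \<lparr>circ_verts = circ_verts G, cross_verts = cross_verts G,
      edges = {(e, i). e \<in> edges G \<and> i \<le> x e},
      circ_end = (\<lambda>(e, i). circ_end G e), cross_end = (\<lambda>(e, i). cross_end G e)\<rparr>"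

definition regular_graph :: "nat \<Rightarrow> ('v, 'e, 'm) bip_multigraph_scheme \<Rightarrow> bool" where
  "regular_graph q G \<longleftrightarrow>
     (\<forall>v \<in> verts G. finite (incident_edges G v) \<and> valence G v = q)"

(* No drawing of the enlarged graph is required: the copies of an edge are to be drawn
   in a thin strip along it, so the only constraint is on the multiplicities. *)
definition extends_to_speiser :: "nat \<Rightarrow> ('v, 'e) drawn_graph \<Rightarrow> bool" where
  "extends_to_speiser q G \<longleftrightarrow>
     (\<exists>x :: 'e \<Rightarrow> nat. bipartite_multigraph (bundle_graph G x) \<and>
        regular_graph q (bundle_graph G x))"

(* Truncated subtraction is harmless, since valences are at most q in a pre-Speiser graph. *)
definition deficiency :: "nat \<Rightarrow> ('v, 'e, 'm) bip_multigraph_scheme \<Rightarrow> 'v \<Rightarrow> nat" where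
  "deficiency q G v = q - valence G v"

(* The sums may have infinitely many nonzero terms; the common value may then be infinity. *)
definition global_balance :: "nat \<Rightarrow> ('v, 'e, 'm) bip_multigraph_scheme \<Rightarrow> bool" where
  "global_balance q G \<longleftrightarrow>
     (\<Sum>\<^sub>\<infinity>v \<in> circ_verts G. enat (deficiency q G v)) =
     (\<Sum>\<^sub>\<infinity>w \<in> cross_verts G. enat (deficiency q G w))"

definition local_balance :: "nat \<Rightarrow> ('v, 'e, 'm) bip_multigraph_scheme \<Rightarrow> bool" where
  "local_balance q G \<longleftrightarrow>
     (\<forall>S. finite S \<and> S \<subseteq> circ_verts G \<longrightarrow>
        (\<Sum>v \<in> S. deficiency q G v) \<le> (\<Sum>w \<in> neighbourhood G S. deficiency q G w)) \<and>
     (\<forall>T. finite T \<and> T \<subseteq> cross_verts G \<longrightarrow>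
        (\<Sum>w \<in> T. deficiency q G w) \<le> (\<Sum>v \<in> neighbourhood G T. deficiency q G v))"

end

theory Submission
  imports Defs
begin

text \<open>
  If \<open>x\<close> solves the extension problem, then the edges at a finite set
  \<open>S\<close> on one side all end in \<open>N(S)\<close>, which gives the Hall inequalities; these in turn force global
  balance, since every finite partial sum on one side is dominated by a finite partial sum on the
  other. Conversely, replace each vertex \<open>v\<close> by \<open>q - \<rho>\<^sub>v\<close> copies. The Hall inequalities give
  injective matchings of the copies in both directions, by the locally finite marriage theorem
  (Rado's argument: a minimal relation satisfying Hall's condition is single-valued). The two
  matchings merge into a perfect one as in the Schroeder-Bernstein theorem, and \<open>x e\<close> counts the
  matched pairs assigned to the edge \<open>e\<close>.
\<close>

section \<open>Marriage theorem for locally finite relations\<close>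

text \<open>Since \<open>card\<close> of an infinite set is 0, the inequality has its usual meaning
  only where images of finite sets are finite; the local finiteness hypotheses below provide
  this.\<close>

definition hall_condition :: "'a set \<Rightarrow> ('a \<times> 'b) set \<Rightarrow> bool" where
  "hall_condition A R \<longleftrightarrow> (\<forall>X. finite X \<and> X \<subseteq> A \<longrightarrow> card X \<le> card (R `` X))"

lemma finite_Image:
  assumes "\<And>a. a \<in> A \<Longrightarrow> finite (R `` {a})" "finite X" "X \<subseteq> A"
  shows "finite (R `` X)"
proof -
  have "R `` X = (\<Union>a\<in>X. R `` {a})" by auto
  then show ?thesis using assms by auto
qed

text \<open>Submodularity of the image size: if sets \<open>X\<close> and \<open>Y\<close> witnessed
  failure for the two removals, their images \<open>P\<close> and \<open>Q\<close> would have sizes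
  adding up to at most \<open>card X + card Y - 2\<close>. But the union and intersection of
  \<open>P\<close> and \<open>Q\<close> have sizes adding up to at least
  \<open>card X + card Y - 1\<close>.\<close>

lemma hall_condition_remove:
  assumes fin: "\<And>a. a \<in> A \<Longrightarrow> finite (R `` {a})"
    and hall: "hall_condition A R"
    and xy: "x \<noteq> y"
  shows "hall_condition A (R - {(a, x)}) \<or> hall_condition A (R - {(a, y)})"
proof (rule ccontr)
  assume "\<not> ?thesis"
  then obtain X Y where X: "finite X" "X \<subseteq> A" "card ((R - {(a, x)}) `` X) < card X"
    and Y: "finite Y" "Y \<subseteq> A" "card ((R - {(a, y)}) `` Y) < card Y"
    unfolding hall_condition_def by (auto simp: not_le)
  define P where "P = (R - {(a, x)}) `` X"
  define Q where "Q = (R - {(a, y)}) `` Y"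
  have le: "card Z \<le> card (R `` Z)" if "finite Z" "Z \<subseteq> A" for Z
    using hall that unfolding hall_condition_def by blast
  have aX: "a \<in> X"
  proof (rule ccontr)
    assume "a \<notin> X"
    then have "(R - {(a, x)}) `` X = R `` X" by auto
    then show False using X le[of X] by simp
  qed
  have aY: "a \<in> Y"
  proof (rule ccontr)
    assume "a \<notin> Y"
    then have "(R - {(a, y)}) `` Y = R `` Y" by auto
    then show False using Y le[of Y] by simp
  qed
  have finP: "finite P"
    by (rule finite_subset[OF _ finite_Image[OF fin X(1,2)]]) (auto simp: P_def)
  have finQ: "finite Q"
    by (rule finite_subset[OF _ finite_Image[OF fin Y(1,2)]]) (auto simp: Q_def)
  \<comment> \<open>Both sets contain \<open>a\<close> and \<open>x\<close> differs from
    \<open>y\<close>, so the pair deleted on one side survives on the other.\<close>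
  have un: "P \<union> Q = R `` (X \<union> Y)"
    using aX aY xy unfolding P_def Q_def by blast
  \<comment> \<open>Only \<open>a\<close> lost a partner; leaving it out of the intersection costs
    exactly 1, less than the total deficit of 2.\<close>
  have int: "R `` (X \<inter> Y - {a}) \<subseteq> P \<inter> Q"
    unfolding P_def Q_def by blast
  have "card (X \<union> Y) \<le> card (P \<union> Q)"
    unfolding un using X Y by (intro le) auto
  moreover have "card (X \<inter> Y - {a}) \<le> card (P \<inter> Q)"
    using X Y by (intro order_trans[OF le card_mono[OF _ int]]) (auto simp: finP)
  moreover have "Suc (card (X \<inter> Y - {a})) = card (X \<inter> Y)"
    using aX aY X by (intro card_Suc_Diff1) auto
  moreover have "card X + card Y = card (X \<union> Y) + card (X \<inter> Y)"
    using X Y by (intro card_Un_Int)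
  moreover have "card P + card Q = card (P \<union> Q) + card (P \<inter> Q)"
    using finP finQ by (intro card_Un_Int)
  moreover have "card P < card X" "card Q < card Y"
    using X Y by (simp_all add: P_def Q_def)
  ultimately show False by linarith
qed

text \<open>The sets \<open>D\<close> of deleted pairs are ordered by inclusion, so that Zorn's
  lemma yields a maximal \<open>D\<close>, hence a minimal \<open>R - D\<close>. There each element
  of \<open>A\<close> has exactly one partner, and these partners form the matching.\<close>

lemma marriage_locally_finite:
  assumes fin: "\<And>a. a \<in> A \<Longrightarrow> finite (R `` {a})"
    and hall: "hall_condition A R"
  obtains f where "inj_on f A" "\<And>a. a \<in> A \<Longrightarrow> (a, f a) \<in> R"
proof -
  let ?\<D> = "{D. hall_condition A (R - D)}"
  have "\<exists>M\<in>?\<D>. \<forall>X\<in>?\<D>. M \<subseteq> X \<longrightarrow> X = M"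
  proof (rule subset_Zorn_nonempty)
    show "?\<D> \<noteq> {}" using hall by (auto intro!: exI[of _ "{}"])
  next
    fix C assume C: "C \<noteq> {}" "subset.chain ?\<D> C"
    have "card X \<le> card ((R - \<Union>C) `` X)" if X: "finite X" "X \<subseteq> A" for X
    proof -
      \<comment> \<open>Only finitely many pairs of \<open>R\<close> start in the finite set
        \<open>X\<close>. Those deleted by the whole chain are therefore already deleted by a single
        member, whose Hall condition applies.\<close>
      let ?F = "R \<inter> (X \<times> UNIV) \<inter> \<Union>C"
      have "finite (R \<inter> (X \<times> UNIV))"
        by (rule finite_subset[OF _ finite_cartesian_product[OF X(1) finite_Image[OF fin X]]]) auto
      then have "finite ?F" by blast
      then obtain D where D: "D \<in> C" "?F \<subseteq> D"
        using finite_subset_Union_chain[of ?F C ?\<D>] C by auto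
      have "(R - \<Union>C) `` X = (R - D) `` X" using D by blast
      moreover have "hall_condition A (R - D)"
        using D C by (auto simp: subset.chain_def)
      ultimately show ?thesis using X by (auto simp: hall_condition_def)
    qed
    then show "\<Union>C \<in> ?\<D>" by (auto simp: hall_condition_def)
  qed
  then obtain D where D: "hall_condition A (R - D)"
    and max: "\<And>X. hall_condition A (R - X) \<Longrightarrow> D \<subseteq> X \<Longrightarrow> X = D" by auto
  have le: "card X \<le> card ((R - D) `` X)" if "finite X" "X \<subseteq> A" for X
    using D that unfolding hall_condition_def by blast
  have uniq: "x = y" if "a \<in> A" "(a, x) \<in> R - D" "(a, y) \<in> R - D" for a x y
  proof (rule ccontr)
    assume "x \<noteq> y"
    have "hall_condition A (R - D - {(a, x)}) \<or> hall_condition A (R - D - {(a, y)})"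
      by (rule hall_condition_remove[OF _ D \<open>x \<noteq> y\<close>]) (auto intro: finite_subset[OF _ fin])
    then have "hall_condition A (R - insert (a, x) D) \<or> hall_condition A (R - insert (a, y) D)"
      by (metis Diff_insert)
    then show False using max[of "insert (a, x) D"] max[of "insert (a, y) D"] that by blast
  qed
  have ex: "\<exists>b. (a, b) \<in> R - D" if "a \<in> A" for a
  proof (rule ccontr)
    assume "\<nexists>b. (a, b) \<in> R - D"
    then have "(R - D) `` {a} = {}" by blast
    then show False using le[of "{a}"] that by simp
  qed
  define f where "f a = (SOME b. (a, b) \<in> R - D)" for a
  have f: "(a, f a) \<in> R - D" if "a \<in> A" for a
    unfolding f_def using ex[OF that] by (rule someI_ex)
  have im: "(R - D) `` X = f ` X" if "X \<subseteq> A" for X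
  proof (intro equalityI subsetI)
    fix b assume "b \<in> (R - D) `` X"
    then obtain a where a: "a \<in> X" "(a, b) \<in> R - D" by blast
    then have "b = f a" using uniq f that by blast
    then show "b \<in> f ` X" using a by simp
  next
    fix b assume "b \<in> f ` X"
    then obtain a where "a \<in> X" "b = f a" by blast
    then show "b \<in> (R - D) `` X" using f that by blast
  qed
  have "inj_on f A"
  proof (rule inj_onI, rule ccontr)
    fix a b assume "a \<in> A" "b \<in> A" "f a = f b" "a \<noteq> b"
    \<comment> \<open>Hall's condition on a set of two elements forbids a common partner.\<close>
    then show False using le[of "{a, b}"] im[of "{a, b}"] by simp
  qed
  then show ?thesis using f that by blast
qed

section \<open>Merging two opposite matchings\<close>

text \<open>The bijection uses only pairs of \<open>f\<close> and reversed pairs of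
  \<open>g\<close>, so it stays inside any relation containing both.\<close>

lemma Schroeder_Bernstein_within:
  assumes f: "inj_on f A" "\<And>a. a \<in> A \<Longrightarrow> f a \<in> B \<and> (a, f a) \<in> R"
    and g: "inj_on g B" "\<And>b. b \<in> B \<Longrightarrow> g b \<in> A \<and> (g b, b) \<in> R"
  obtains h where "bij_betw h A B" "\<And>a. a \<in> A \<Longrightarrow> (a, h a) \<in> R"
proof -
  define X where "X = lfp (\<lambda>X. A - g ` (B - f ` X))"
  have "mono (\<lambda>X. A - g ` (B - f ` X))" by (rule monoI) blast
  then have X: "X = A - g ` (B - f ` X)" unfolding X_def by (rule lfp_unfold)
  define k where "k = inv_into B g"
  define h where "h a = (if a \<in> X then f a else k a)" for a
  have XA: "X \<subseteq> A" by (subst X) blast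
  have "A - X = A - (A - g ` (B - f ` X))" using X by (rule arg_cong)
  also have "\<dots> = g ` (B - f ` X)" using g(2) by blast
  finally have AX: "A - X = g ` (B - f ` X)" .
  have kg: "k (g b) = b" if "b \<in> B" for b
    unfolding k_def using g(1) that by (rule inv_into_f_f)
  have "bij_betw f X (f ` X)"
    using f(1) XA by (metis bij_betw_def inj_on_subset)
  then have "bij_betw h X (f ` X)"
    by (subst bij_betw_cong[of X h f]) (auto simp: h_def)
  moreover have "bij_betw h (A - X) (B - f ` X)"
  proof (rule bij_betw_byWitness[where f' = g])
    have hg: "h (g b) = b" if "b \<in> B - f ` X" for b
    proof -
      have "g b \<in> A - X" unfolding AX using that by (rule imageI)
      then show ?thesis using kg that by (simp add: h_def)
    qed
    then show "\<forall>b\<in>B - f ` X. h (g b) = b" by blast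
    show "\<forall>a\<in>A - X. g (h a) = a" "h ` (A - X) \<subseteq> B - f ` X" "g ` (B - f ` X) \<subseteq> A - X"
      unfolding AX using hg by auto
  qed
  ultimately have "bij_betw h (X \<union> (A - X)) (f ` X \<union> (B - f ` X))"
    by (rule bij_betw_combine) auto
  moreover have "X \<union> (A - X) = A" "f ` X \<union> (B - f ` X) = B" using XA f(2) by auto
  ultimately have "bij_betw h A B" by simp
  moreover have "(a, h a) \<in> R" if "a \<in> A" for a
  proof (cases "a \<in> X")
    case True
    then show ?thesis using f(2)[OF that] by (simp add: h_def)
  next
    case False
    then have "a \<in> g ` (B - f ` X)" unfolding AX[symmetric] using that by simp
    then obtain b where b: "b \<in> B" "a = g b" by blast
    then have "h a = b" using False kg by (simp add: h_def)
    then show ?thesis using b g(2) by simp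
  qed
  ultimately show ?thesis by (rule that)
qed

section \<open>Weighted marriage through copies of vertices\<close>

abbreviation copies :: "'a set \<Rightarrow> ('a \<Rightarrow> nat) \<Rightarrow> ('a \<times> nat) set" where
  "copies V d \<equiv> SIGMA v:V. {..<d v}"

text \<open>All copies of a vertex have the same possible partners, so Hall's condition is tightest
  on sets containing every copy of their vertices. There it is the weighted inequality
  \<open>le\<close>.\<close>

lemma marriage_copies:
  fixes R :: "('a \<times> 'b) set"
  assumes fin: "\<And>v. v \<in> V \<Longrightarrow> finite (R `` {v})"
    and W: "R `` V \<subseteq> W"
    and le: "\<And>S. finite S \<Longrightarrow> S \<subseteq> V \<Longrightarrow> sum d S \<le> sum d' (R `` S)"
  obtains f where "inj_on f (copies V d)"
    "\<And>a. a \<in> copies V d \<Longrightarrow> f a \<in> copies W d' \<and> (fst a, fst (f a)) \<in> R"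
proof -
  define P :: "(('a \<times> nat) \<times> ('b \<times> nat)) set"
    where "P = {(a, b). (fst a, fst b) \<in> R \<and> b \<in> copies W d'}"
  have PX: "P `` X = copies (R `` (fst ` X)) d'" if "X \<subseteq> copies V d" for X
  proof (intro equalityI subsetI)
    fix b assume "b \<in> P `` X"
    then obtain a where "a \<in> X" "(fst a, fst b) \<in> R" "b \<in> copies W d'"
      unfolding P_def by blast
    then have "fst b \<in> R `` (fst ` X)" "b \<in> copies W d'" by blast+
    then show "b \<in> copies (R `` (fst ` X)) d'" by (cases b) simp
  next
    fix b assume b: "b \<in> copies (R `` (fst ` X)) d'"
    then have "fst b \<in> R `` (fst ` X)" by (cases b) simp
    then obtain a where a: "a \<in> X" "(fst a, fst b) \<in> R" by blast
    then have "a \<in> copies V d" using that by blast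
    then have "fst b \<in> W" using W a(2) by (cases a) auto
    then have "(a, b) \<in> P" using a b unfolding P_def by (cases b) simp
    then show "b \<in> P `` X" using a by blast
  qed
  have "finite (P `` {a})" if "a \<in> copies V d" for a
    using that fin by (subst PX) (auto intro!: finite_SigmaI)
  moreover have "hall_condition (copies V d) P"
    unfolding hall_condition_def
  proof safe
    fix X assume X: "finite X" "X \<subseteq> copies V d"
    have S: "finite (fst ` X)" "fst ` X \<subseteq> V" using X by auto
    have finS: "finite (R `` (fst ` X))" using fin S by (rule finite_Image)
    have "card X \<le> card (copies (fst ` X) d)"
      using X S by (intro card_mono) force+
    also have "\<dots> = sum d (fst ` X)" using S by (simp add: card_SigmaI)
    also have "\<dots> \<le> sum d' (R `` (fst ` X))" using S by (rule le)
    also have "\<dots> = card (P `` X)" unfolding PX[OF X(2)] using finS by (simp add: card_SigmaI)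
    finally show "card X \<le> card (P `` X)" .
  qed
  ultimately obtain f where "inj_on f (copies V d)" "\<And>a. a \<in> copies V d \<Longrightarrow> (a, f a) \<in> P"
    by (rule marriage_locally_finite) auto
  then show ?thesis using that by (auto simp: P_def)
qed

section \<open>Adjacency and valence in the bipartite multigraph\<close>

text \<open>Adjacency oriented from circle to cross vertices, with multiplicities forgotten; the
  converse relation serves the other side.\<close>

definition edge_rel :: "('v, 'e, 'm) bip_multigraph_scheme \<Rightarrow> ('v \<times> 'v) set" where
  "edge_rel G = (\<lambda>e. (circ_end G e, cross_end G e)) ` edges G"

lemma edge_rel_subset:
  assumes "bipartite_multigraph G"
  shows "edge_rel G \<subseteq> circ_verts G \<times> cross_verts G"
  using assms by (auto simp: edge_rel_def bipartite_multigraph_def)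

text \<open>An edge meets each class in one end, which excludes the reversed reading of the
  unordered pair.\<close>

lemma adjacent_circ:
  assumes "bipartite_multigraph G" "v \<in> circ_verts G"
  shows "adjacent G v w \<longleftrightarrow> (v, w) \<in> edge_rel G"
proof -
  have "{circ_end G e, cross_end G e} = {v, w} \<longleftrightarrow> (v, w) = (circ_end G e, cross_end G e)"
    if "e \<in> edges G" for e
  proof -
    have "cross_end G e \<noteq> v" using assms that unfolding bipartite_multigraph_def by blast
    then show ?thesis unfolding doubleton_eq_iff prod.inject by metis
  qed
  then show ?thesis unfolding adjacent_def edge_rel_def image_iff by blast
qed

lemma adjacent_cross:
  assumes "bipartite_multigraph G" "w \<in> cross_verts G"
  shows "adjacent G w v \<longleftrightarrow> (v, w) \<in> edge_rel G"
proof -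
  have "{circ_end G e, cross_end G e} = {w, v} \<longleftrightarrow> (v, w) = (circ_end G e, cross_end G e)"
    if "e \<in> edges G" for e
  proof -
    have "circ_end G e \<noteq> w" using assms that unfolding bipartite_multigraph_def by blast
    then show ?thesis unfolding doubleton_eq_iff prod.inject by metis
  qed
  then show ?thesis unfolding adjacent_def edge_rel_def image_iff by blast
qed

text \<open>Neighbours lie in the opposite class, so subtracting \<open>S\<close> removes
  nothing.\<close>

lemma neighbourhood_circ:
  assumes "bipartite_multigraph G" "S \<subseteq> circ_verts G"
  shows "neighbourhood G S = edge_rel G `` S"
proof -
  have "(\<Union>v\<in>S. {w. adjacent G v w}) = edge_rel G `` S"
    using assms(2) adjacent_circ[OF assms(1)] by blast
  moreover have "edge_rel G `` S \<inter> S = {}"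
    using assms edge_rel_subset[OF assms(1)] unfolding bipartite_multigraph_def by blast
  ultimately show ?thesis unfolding neighbourhood_def by blast
qed

lemma neighbourhood_cross:
  assumes "bipartite_multigraph G" "T \<subseteq> cross_verts G"
  shows "neighbourhood G T = (edge_rel G)\<inverse> `` T"
proof -
  have "(\<Union>v\<in>T. {w. adjacent G v w}) = (edge_rel G)\<inverse> `` T"
    using assms(2) adjacent_cross[OF assms(1)] by blast
  moreover have "(edge_rel G)\<inverse> `` T \<inter> T = {}"
    using assms edge_rel_subset[OF assms(1)] unfolding bipartite_multigraph_def by blast
  ultimately show ?thesis unfolding neighbourhood_def by blast
qed

lemma incident_edges_circ:
  assumes "bipartite_multigraph G" "v \<in> circ_verts G"
  shows "incident_edges G v = {e \<in> edges G. circ_end G e = v}"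
  using assms by (auto simp: incident_edges_def bipartite_multigraph_def)

lemma incident_edges_cross:
  assumes "bipartite_multigraph G" "w \<in> cross_verts G"
  shows "incident_edges G w = {e \<in> edges G. cross_end G e = w}"
  using assms by (auto simp: incident_edges_def bipartite_multigraph_def)

lemma finite_edge_rel_Image:
  assumes "finite S" "\<And>v. v \<in> S \<Longrightarrow> finite (incident_edges G v)"
  shows "finite (edge_rel G `` S)" "finite ((edge_rel G)\<inverse> `` S)"
proof -
  have fin: "finite (\<Union>v\<in>S. incident_edges G v)" using assms by blast
  show "finite (edge_rel G `` S)"
    by (rule finite_subset[OF _ finite_imageI[OF fin, of "cross_end G"]])
      (auto simp: edge_rel_def incident_edges_def)
  show "finite ((edge_rel G)\<inverse> `` S)"
    by (rule finite_subset[OF _ finite_imageI[OF fin, of "circ_end G"]])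
      (auto simp: edge_rel_def incident_edges_def)
qed

text \<open>The indices in \<open>{..x e}\<close> include 0, so an edge contributes
  \<open>Suc (x e)\<close>; the ones add up to the old valence.\<close>

lemma valence_bundle_graph:
  assumes "finite (incident_edges G v)"
  shows "finite (incident_edges (bundle_graph G x) v)"
    and "valence (bundle_graph G x) v = valence G v + sum x (incident_edges G v)"
proof -
  have eq: "incident_edges (bundle_graph G x) v = (SIGMA e:incident_edges G v. {..x e})"
    by (auto simp: incident_edges_def bundle_graph_def)
  show "finite (incident_edges (bundle_graph G x) v)"
    unfolding eq using assms by auto
  show "valence (bundle_graph G x) v = valence G v + sum x (incident_edges G v)"
    unfolding valence_def eq using assms by (simp add: card_SigmaI sum_Suc)
qed

text \<open>As valences are at most \<open>q\<close>, the truncated difference is exact, and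
  regularity becomes a linear system for the multiplicities \<open>x\<close>.\<close>

lemma extends_to_speiser_iff:
  assumes bip: "bipartite_multigraph G"
    and fin: "\<And>v. v \<in> verts G \<Longrightarrow> finite (incident_edges G v)"
    and le: "\<And>v. v \<in> verts G \<Longrightarrow> valence G v \<le> q"
  shows "extends_to_speiser q G \<longleftrightarrow>
    (\<exists>x. \<forall>v\<in>verts G. sum x (incident_edges G v) = deficiency q G v)"
proof -
  have "bipartite_multigraph (bundle_graph G x)" for x
    using bip by (auto simp: bipartite_multigraph_def bundle_graph_def)
  moreover have "regular_graph q (bundle_graph G x) \<longleftrightarrow>
      (\<forall>v\<in>verts G. sum x (incident_edges G v) = deficiency q G v)" for x
  proof -
    have "verts (bundle_graph G x) = verts G"
      by (simp add: verts_def bundle_graph_def)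
    moreover have "valence (bundle_graph G x) v = q \<longleftrightarrow>
        sum x (incident_edges G v) = deficiency q G v" if "v \<in> verts G" for v
      using valence_bundle_graph(2)[OF fin[OF that], of x] le[OF that]
      unfolding deficiency_def by linarith
    moreover have "finite (incident_edges (bundle_graph G x) v)" if "v \<in> verts G" for v
      using fin[OF that] by (rule valence_bundle_graph)
    ultimately show ?thesis by (simp add: regular_graph_def)
  qed
  ultimately show ?thesis by (simp add: extends_to_speiser_def)
qed

section \<open>From edge multiplicities to the balance conditions\<close>

lemma local_balance_iff:
  assumes "bipartite_multigraph G"
  shows "local_balance q G \<longleftrightarrow>
    (\<forall>S. finite S \<and> S \<subseteq> circ_verts G \<longrightarrow>
      sum (deficiency q G) S \<le> sum (deficiency q G) (edge_rel G `` S)) \<and>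
    (\<forall>T. finite T \<and> T \<subseteq> cross_verts G \<longrightarrow>
      sum (deficiency q G) T \<le> sum (deficiency q G) ((edge_rel G)\<inverse> `` T))"
  by (simp add: local_balance_def neighbourhood_circ[OF assms] neighbourhood_cross[OF assms])

text \<open>Disjointness makes the left side a sum over one union of edge sets; the right side
  counts every edge of the larger union at least once.\<close>

lemma sum_incident_le:
  fixes x :: "'e \<Rightarrow> nat"
  assumes S: "finite S" "finite N"
    and fin: "\<And>w. w \<in> N \<Longrightarrow> finite (I w)"
    and disj: "\<And>v v'. v \<in> S \<Longrightarrow> v' \<in> S \<Longrightarrow> v \<noteq> v' \<Longrightarrow> I v \<inter> I v' = {}"
    and sub: "(\<Union>v\<in>S. I v) \<subseteq> (\<Union>w\<in>N. I w)"
  shows "(\<Sum>v\<in>S. sum x (I v)) \<le> (\<Sum>w\<in>N. sum x (I w))"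
proof -
  have finU: "finite (\<Union>w\<in>N. I w)" using S fin by auto
  have "finite (I v)" if "v \<in> S" for v
    using that by (intro finite_subset[OF _ finite_subset[OF sub finU]]) auto
  then have "(\<Sum>v\<in>S. sum x (I v)) = sum x (\<Union>v\<in>S. I v)"
    using S disj by (subst sum.UNION_disjoint) auto
  also have "\<dots> \<le> sum x (\<Union>w\<in>N. I w)"
    using finU sub by (intro sum_mono2) auto
  also have "\<dots> \<le> (\<Sum>w\<in>N. sum x (I w))"
    using S(2) fin
  proof (induction N rule: finite_induct)
    case (insert w N)
    have "sum x (I w \<union> (\<Union>w\<in>N. I w)) \<le> sum x (I w) + sum x (\<Union>w\<in>N. I w)"
      using insert by (subst sum_Un_nat) auto
    then show ?case using insert by fastforce
  qed simp
  finally show ?thesis .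
qed

lemma local_balance_if_solution:
  assumes bip: "bipartite_multigraph G"
    and fin: "\<And>v. v \<in> verts G \<Longrightarrow> finite (incident_edges G v)"
    and x: "\<And>v. v \<in> verts G \<Longrightarrow> sum x (incident_edges G v) = deficiency q G v"
  shows "local_balance q G"
proof -
  have ends: "circ_end G e \<in> circ_verts G" "cross_end G e \<in> cross_verts G" if "e \<in> edges G" for e
    using bip that by (auto simp: bipartite_multigraph_def)
  \<comment> \<open>Common to both classes: edges at distinct vertices of one class are distinct,
    and each has its other end in the neighbourhood \<open>N\<close>.\<close>
  have *: "sum (deficiency q G) S \<le> sum (deficiency q G) N"
    if "finite S" "S \<subseteq> verts G" "finite N" "N \<subseteq> verts G"
      and "\<And>v v'. v \<in> S \<Longrightarrow> v' \<in> S \<Longrightarrow> v \<noteq> v' \<Longrightarrow> incident_edges G v \<inter> incident_edges G v' = {}"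
      and "(\<Union>v\<in>S. incident_edges G v) \<subseteq> (\<Union>w\<in>N. incident_edges G w)" for S N
  proof -
    have "(\<Sum>v\<in>S. sum x (incident_edges G v)) \<le> (\<Sum>w\<in>N. sum x (incident_edges G w))"
      by (rule sum_incident_le) (use that fin in auto)
    then show ?thesis using x that by (simp add: subset_iff)
  qed
  show ?thesis
    unfolding local_balance_iff[OF bip]
  proof safe
    fix S assume S: "finite S" "S \<subseteq> circ_verts G"
    show "sum (deficiency q G) S \<le> sum (deficiency q G) (edge_rel G `` S)"
    proof (rule *)
      show "finite (edge_rel G `` S)"
        using S by (intro finite_edge_rel_Image fin)
          (auto simp: verts_def)
      show "edge_rel G `` S \<subseteq> verts G" using ends by (auto simp: edge_rel_def verts_def)
      show "(\<Union>v\<in>S. incident_edges G v) \<subseteq> (\<Union>w\<in>edge_rel G `` S. incident_edges G w)"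
        using S incident_edges_circ[OF bip]
        by (auto simp: edge_rel_def incident_edges_def subset_iff)
      show "incident_edges G v \<inter> incident_edges G v' = {}"
        if "v \<in> S" "v' \<in> S" "v \<noteq> v'" for v v'
        using that S by (auto simp: incident_edges_circ[OF bip] subset_iff)
    qed (use S in \<open>auto simp: verts_def\<close>)
  next
    fix T assume T: "finite T" "T \<subseteq> cross_verts G"
    show "sum (deficiency q G) T \<le> sum (deficiency q G) ((edge_rel G)\<inverse> `` T)"
    proof (rule *)
      show "finite ((edge_rel G)\<inverse> `` T)"
        using T by (intro finite_edge_rel_Image fin)
          (auto simp: verts_def)
      show "(edge_rel G)\<inverse> `` T \<subseteq> verts G" using ends by (auto simp: edge_rel_def verts_def)
      show "(\<Union>v\<in>T. incident_edges G v) \<subseteq> (\<Union>w\<in>(edge_rel G)\<inverse> `` T. incident_edges G w)"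
        using T incident_edges_cross[OF bip]
        by (auto simp: edge_rel_def incident_edges_def subset_iff)
      show "incident_edges G v \<inter> incident_edges G v' = {}"
        if "v \<in> T" "v' \<in> T" "v \<noteq> v'" for v v'
        using that T by (auto simp: incident_edges_cross[OF bip] subset_iff)
    qed (use T in \<open>auto simp: verts_def\<close>)
  qed
qed

text \<open>In \<open>enat\<close> an infinite sum is the supremum of its finite partial sums, so
  the comparison also covers the value infinity.\<close>

lemma infsum_enat_le:
  fixes d :: "'a \<Rightarrow> nat" and d' :: "'b \<Rightarrow> nat"
  assumes "\<And>S. finite S \<Longrightarrow> S \<subseteq> V \<Longrightarrow> \<exists>N. finite N \<and> N \<subseteq> W \<and> sum d S \<le> sum d' N"
  shows "(\<Sum>\<^sub>\<infinity>v\<in>V. enat (d v)) \<le> (\<Sum>\<^sub>\<infinity>w\<in>W. enat (d' w))"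
proof -
  have of_sum: "(\<Sum>a\<in>A. enat (f a)) = enat (sum f A)" for f :: "'c \<Rightarrow> nat" and A
    by (induction A rule: infinite_finite_induct) (auto simp: zero_enat_def)
  show ?thesis
    by (subst (1 2) nonneg_infsum_complete)
      (use assms in \<open>auto simp: of_sum intro!: SUP_mono\<close>)
qed

text \<open>The neighbourhood of a finite set is finite and dominates it by Hall's inequality; doing
  this from both sides gives two opposite inequalities.\<close>

lemma global_balance_if_local_balance:
  assumes bip: "bipartite_multigraph G"
    and fin: "\<And>v. v \<in> verts G \<Longrightarrow> finite (incident_edges G v)"
    and loc: "local_balance q G"
  shows "global_balance q G"
  unfolding global_balance_def
proof (rule antisym; rule infsum_enat_le)
  fix S assume S: "finite S" "S \<subseteq> circ_verts G"
  have "finite (edge_rel G `` S)"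
    using S by (intro finite_edge_rel_Image fin)
      (auto simp: verts_def)
  moreover have "edge_rel G `` S \<subseteq> cross_verts G" using edge_rel_subset[OF bip] by auto
  ultimately show "\<exists>N. finite N \<and> N \<subseteq> cross_verts G \<and> sum (deficiency q G) S \<le> sum (deficiency q G) N"
    using loc S unfolding local_balance_iff[OF bip] by blast
next
  fix T assume T: "finite T" "T \<subseteq> cross_verts G"
  have "finite ((edge_rel G)\<inverse> `` T)"
    using T by (intro finite_edge_rel_Image fin)
      (auto simp: verts_def)
  moreover have "(edge_rel G)\<inverse> `` T \<subseteq> circ_verts G" using edge_rel_subset[OF bip] by auto
  ultimately show "\<exists>N. finite N \<and> N \<subseteq> circ_verts G \<and> sum (deficiency q G) T \<le> sum (deficiency q G) N"
    using loc T unfolding local_balance_iff[OF bip] by blast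
qed

section \<open>From Hall's inequalities to edge multiplicities\<close>

lemma sum_card_fibres:
  assumes "finite I" "finite {a \<in> A. m a \<in> I}"
  shows "(\<Sum>e\<in>I. card {a \<in> A. m a = e}) = card {a \<in> A. m a \<in> I}"
proof -
  have "{a \<in> A. m a \<in> I} = (\<Union>e\<in>I. {a \<in> A. m a = e})" by auto
  moreover have "card (\<Union>e\<in>I. {a \<in> A. m a = e}) = (\<Sum>e\<in>I. card {a \<in> A. m a = e})"
    using assms by (intro card_UN_disjoint) (auto intro: finite_subset[OF _ assms(2)])
  ultimately show ?thesis by simp
qed

lemma fibre_copies:
  assumes "v \<in> V"
  shows "finite {a \<in> copies V d. fst a = v}" "card {a \<in> copies V d. fst a = v} = d v"
proof -
  have "{a \<in> copies V d. fst a = v} = {v} \<times> {..<d v}" using assms by auto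
  then show "finite {a \<in> copies V d. fst a = v}" "card {a \<in> copies V d. fst a = v} = d v"
    by (simp_all add: card_cartesian_product)
qed

lemma solution_if_local_balance:
  assumes bip: "bipartite_multigraph G"
    and fin: "\<And>v. v \<in> verts G \<Longrightarrow> finite (incident_edges G v)"
    and loc: "local_balance q G"
  shows "\<exists>x. \<forall>v\<in>verts G. sum x (incident_edges G v) = deficiency q G v"
proof -
  let ?d = "deficiency q G" and ?R = "edge_rel G"
  let ?A = "copies (circ_verts G) ?d" and ?B = "copies (cross_verts G) ?d"
  have R: "?R `` circ_verts G \<subseteq> cross_verts G" "?R\<inverse> `` cross_verts G \<subseteq> circ_verts G"
    using edge_rel_subset[OF bip] by auto
  have finR: "finite (?R `` {v})" if "v \<in> circ_verts G" for v
    using that by (intro finite_edge_rel_Image fin) (auto simp: verts_def)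
  have finR': "finite (?R\<inverse> `` {w})" if "w \<in> cross_verts G" for w
    using that by (intro finite_edge_rel_Image fin) (auto simp: verts_def)
  have le: "sum ?d S \<le> sum ?d (?R `` S)" if "finite S" "S \<subseteq> circ_verts G" for S
    using loc that unfolding local_balance_iff[OF bip] by blast
  have le': "sum ?d T \<le> sum ?d (?R\<inverse> `` T)" if "finite T" "T \<subseteq> cross_verts G" for T
    using loc that unfolding local_balance_iff[OF bip] by blast
  obtain f where f: "inj_on f ?A" "\<And>a. a \<in> ?A \<Longrightarrow> f a \<in> ?B \<and> (fst a, fst (f a)) \<in> ?R"
    using marriage_copies[OF finR R(1) le] by blast
  obtain g where g: "inj_on g ?B" "\<And>b. b \<in> ?B \<Longrightarrow> g b \<in> ?A \<and> (fst b, fst (g b)) \<in> ?R\<inverse>"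
    using marriage_copies[OF finR' R(2) le'] by blast
  obtain h where h: "bij_betw h ?A ?B"
    and "\<And>a. a \<in> ?A \<Longrightarrow> (a, h a) \<in> {(a, b). (fst a, fst b) \<in> ?R}"
    by (rule Schroeder_Bernstein_within[OF f(1) _ g(1), of "{(a, b). (fst a, fst b) \<in> ?R}"])
      (use f(2) g(2) in auto)
  then have "\<forall>a\<in>?A. \<exists>e\<in>edges G. circ_end G e = fst a \<and> cross_end G e = fst (h a)"
    by (fastforce simp: edge_rel_def)
  \<comment> \<open>Among parallel edges any choice will do, since only the ends of
    \<open>m a\<close> enter the sums at the vertices.\<close>
  then obtain m where m: "\<And>a. a \<in> ?A \<Longrightarrow>
      m a \<in> edges G \<and> circ_end G (m a) = fst a \<and> cross_end G (m a) = fst (h a)"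
    by metis
  define x where "x e = card {a \<in> ?A. m a = e}" for e
  have circ: "sum x (incident_edges G v) = ?d v" if v: "v \<in> circ_verts G" for v
  proof -
    \<comment> \<open>The chosen edge of \<open>a\<close> meets \<open>v\<close> exactly when
      \<open>a\<close> is a copy of \<open>v\<close>, and there are \<open>?d v\<close> such
      copies.\<close>
    have eq: "{a \<in> ?A. m a \<in> incident_edges G v} = {a \<in> ?A. fst a = v}"
      unfolding incident_edges_circ[OF bip v] by (intro Collect_cong conj_cong refl) (simp add: m)
    have "finite (incident_edges G v)" using fin v by (simp add: verts_def)
    then have "sum x (incident_edges G v) = card {a \<in> ?A. m a \<in> incident_edges G v}"
      unfolding x_def by (rule sum_card_fibres) (unfold eq, rule fibre_copies(1)[OF v])
    also have "\<dots> = ?d v" unfolding eq by (rule fibre_copies(2)[OF v])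
    finally show ?thesis .
  qed
  have cross: "sum x (incident_edges G w) = ?d w" if w: "w \<in> cross_verts G" for w
  proof -
    have eq: "{a \<in> ?A. m a \<in> incident_edges G w} = {a \<in> ?A. fst (h a) = w}"
      unfolding incident_edges_cross[OF bip w] by (intro Collect_cong conj_cong refl) (simp add: m)
    \<comment> \<open>On the cross side the count is transported along \<open>h\<close>:
      surjectivity onto \<open>?B\<close> ensures that every copy of \<open>w\<close> is
      matched.\<close>
    have "h ` {a \<in> ?A. fst (h a) = w} = {b \<in> ?B. fst b = w}"
      unfolding bij_betw_imp_surj_on[OF h, symmetric] by blast
    then have bij: "bij_betw h {a \<in> ?A. fst (h a) = w} {b \<in> ?B. fst b = w}"
      by (intro bij_betw_subset[OF h]) auto
    have "finite (incident_edges G w)" using fin w by (simp add: verts_def)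
    then have "sum x (incident_edges G w) = card {a \<in> ?A. m a \<in> incident_edges G w}"
      unfolding x_def
      by (rule sum_card_fibres) (unfold eq bij_betw_finite[OF bij], rule fibre_copies(1)[OF w])
    also have "\<dots> = ?d w"
      unfolding eq bij_betw_same_card[OF bij] by (rule fibre_copies(2)[OF w])
    finally show ?thesis .
  qed
  show ?thesis using circ cross by (auto simp: verts_def)
qed

theorem theorem8p5:
  fixes G :: "('v, 'e) drawn_graph" and q :: nat
  assumes "2 \<le> q"
    and "pre_speiser_graph q G"
    and "circ_verts G \<approx> cross_verts G"
    and "\<And>v. v \<in> verts G \<Longrightarrow> 2 \<le> valence G v \<and> valence G v \<le> q"
    and "finite {F \<in> faces G. \<not> digon G F} \<longrightarrow> q \<le> card {F \<in> faces G. \<not> digon G F}"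
  shows "extends_to_speiser q G \<longleftrightarrow> global_balance q G \<and> local_balance q G"
proof -
  have bip: "bipartite_multigraph G"
    and fin: "\<And>v. v \<in> verts G \<Longrightarrow> finite (incident_edges G v)"
    and le: "\<And>v. v \<in> verts G \<Longrightarrow> valence G v \<le> q"
    using assms(2) by (auto simp: pre_speiser_graph_def)
  have "extends_to_speiser q G \<longleftrightarrow>
      (\<exists>x. \<forall>v\<in>verts G. sum x (incident_edges G v) = deficiency q G v)"
    using bip fin le by (rule extends_to_speiser_iff)
  also have "\<dots> \<longleftrightarrow> local_balance q G"
    using local_balance_if_solution[OF bip fin] solution_if_local_balance[OF bip fin] by blast
  also have "\<dots> \<longleftrightarrow> global_balance q G \<and> local_balance q G"
    using global_balance_if_local_balance[OF bip fin] by blast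
  finally show ?thesis .
qed

end
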